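(* Peano Arithmetic $\mathsf{PA}$ is consistent with respect to the support relation; that is, $\mathsf{PA}\not\Vdash\bot$.
   Context: **Language.** The language of arithmetic has signature $\langle 0,S,+,\cdot\rangle$ ($0$ a constant, $S$ unary, $+$ and $\cdot$ binary function symbols) and the single predicate symbol $=$ (binary). Atomic formulas (atoms) are predicates applied to terms; the logical constant $\bot$ is not atomic. Formulas are built from atoms and $\bot$ using $\to$ and $\forall$; $\neg\varphi$ abbreviates $\varphi\to\bot$ and $\varphi\land\psi$ abbreviates $(\varphi\to(\psi\to\bot))\to\bot$. **Bases.** An atomic rule is an inference figure with finitely many (possibly zero) atomic premises $P_1,\dots,P_n$ and an atomic conclusion $C$. A base $\mathfrak{B}$ is a set of atomic rules. An atom $A$ is derivable in $\mathfrak{B}$ if it can be obtained by composing rules of $\mathfrak{B}$ (i.e. $A$ belongs to the least set of atoms closed under the rules of $\mathfrak{B}$). **Support.** For bases $\mathfrak{B}$, closed formulas, and non-empty finite sets $\Delta$ of closed formulas, support is defined inductively by: - for a closed atom $A$: $\Vdash_{\mathfrak{B}} A$ iff $A$ is derivable in $\mathfrak{B}$; - $\Vdash_{\mathfrak{B}} \varphi\to\psi$ iff $\{\varphi\} \Vdash_{\mathfrak{B}} \psi$; - $\Vdash_{\mathfrak{B}} \forall x\,\varphi$ iff $\Vdash_{\mathfrak{B}} \varphi[x\mapsto t]$ for all closed terms $t$; - $\Vdash_{\mathfrak{B}} \bot$ iff $\Vdash_{\mathfrak{B}} A$ for every closed atom $A$; - $\Delta \Vdash_{\mathfrak{B}}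 \varphi$ iff for all bases $\mathfrak{C}\supseteq\mathfrak{B}$, if $\Vdash_{\mathfrak{C}} \psi$ for all $\psi\in\Delta$, then $\Vdash_{\mathfrak{C}} \varphi$. For finite $\Delta$, $\Delta\Vdash\varphi$ means $\Delta\Vdash_{\mathfrak{B}}\varphi$ for every base $\mathfrak{B}$. For an arbitrary (possibly infinite) set $\Gamma$ of closed formulas, $\Gamma\Vdash\varphi$ iff $\Delta\Vdash\varphi$ for some finite $\Delta\subseteq\Gamma$. **Consistency.** A theory (set of closed formulas) $\Gamma$ is consistent iff $\Gamma\not\Vdash\bot$. **Peano Arithmetic.** $\mathsf{PA}$ is the set consisting of the following axioms, for all formulas $\varphi$ (schema instances being universally closed if $\varphi$ has further free variables): - (EQ1) $\forall x(x=x)$; - (EQ2) $\forall x,y(x=y\to y=x)$; - (EQ3) $\forall x,y,z(x=y\to(y=z\to x=z))$; - (EQ4($\varphi$)) $\forall x,y(x=y\to(\varphi(x)\to\varphi(y)))$; - (PA1) $\forall x(\neg(S(x)=0))$; - (PA2) $\forall x,y(S(x)=S(y)\to x=y)$; - (PA3) $\forall x(x+0=x)$; - (PA4) $\forall x,y(x+S(y)=S(x+y))$; - (PA5) $\forall x(x\cdot 0=0)$; - (PA6) $\forall x,y(x\cdot S(y)=x\cdot y+x)$; - (PA7($\varphi$)) $\bigl(\varphi(0)\land\forall x(\varphi(x)\to\varphi(S(x)))\bigr)\to\forall x\,\varphi(x)$. *)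

theory Defs
  imports Main
begin

datatype tm =
    Var nat
  | Zero
  | Succ tm
  | Plus tm tm
  | Times tm tm

datatype atom = Eq tm tm

datatype fm =
    Atom atom
  | Bot
  | Imp fm fm
  | Forall nat fm

abbreviation Equ :: "tm \<Rightarrow> tm \<Rightarrow> fm" where
  "Equ s t \<equiv> Atom (Eq s t)"

abbreviation Neg :: "fm \<Rightarrow> fm" where
  "Neg \<phi> \<equiv> Imp \<phi> Bot"

abbreviation Conj :: "fm \<Rightarrow> fm \<Rightarrow> fm" where
  "Conj \<phi> \<psi> \<equiv> Imp (Imp \<phi> (Imp \<psi> Bot)) Bot"

primrec fv_tm :: "tm \<Rightarrow> nat set" where
  "fv_tm (Var y) = {y}"
| "fv_tm Zero = {}"
| "fv_tm (Succ t) = fv_tm t"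
| "fv_tm (Plus s t) = fv_tm s \<union> fv_tm t"
| "fv_tm (Times s t) = fv_tm s \<union> fv_tm t"

primrec fv_atom :: "atom \<Rightarrow> nat set" where
  "fv_atom (Eq s t) = fv_tm s \<union> fv_tm t"

primrec fv :: "fm \<Rightarrow> nat set" where
  "fv (Atom a) = fv_atom a"
| "fv Bot = {}"
| "fv (Imp \<phi> \<psi>) = fv \<phi> \<union> fv \<psi>"
| "fv (Forall y \<phi>) = fv \<phi> - {y}"

definition closed_tm :: "tm \<Rightarrow> bool" where
  "closed_tm t \<longleftrightarrow> fv_tm t = {}"

definition closed_atom :: "atom \<Rightarrow> bool" where
  "closed_atom a \<longleftrightarrow> fv_atom a = {}"

definition closed_fm :: "fm \<Rightarrow> bool" where
  "closed_fm \<phi> \<longleftrightarrow> fv \<phi> = {}"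

primrec subst_tm :: "nat \<Rightarrow> tm \<Rightarrow> tm \<Rightarrow> tm" where
  "subst_tm x t (Var y) = (if y = x then t else Var y)"
| "subst_tm x t Zero = Zero"
| "subst_tm x t (Succ s) = Succ (subst_tm x t s)"
| "subst_tm x t (Plus s u) = Plus (subst_tm x t s) (subst_tm x t u)"
| "subst_tm x t (Times s u) = Times (subst_tm x t s) (subst_tm x t u)"

primrec subst_atom :: "nat \<Rightarrow> tm \<Rightarrow> atom \<Rightarrow> atom" where
  "subst_atom x t (Eq s u) = Eq (subst_tm x t s) (subst_tm x t u)"

text \<open>
  \<open>subst x t \<phi>\<close> replaces the free occurrences of \<open>x\<close> and never renames bound variables. It is
  used only where \<open>t\<close> is substitutable for \<open>x\<close>: when \<open>t\<close> is closed, when its only variable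
  is \<open>x\<close> itself, or under the explicit side condition \<open>substitutable\<close>.
\<close>

primrec subst :: "nat \<Rightarrow> tm \<Rightarrow> fm \<Rightarrow> fm" where
  "subst x t (Atom a) = Atom (subst_atom x t a)"
| "subst x t Bot = Bot"
| "subst x t (Imp \<phi> \<psi>) = Imp (subst x t \<phi>) (subst x t \<psi>)"
| "subst x t (Forall y \<phi>) = (if y = x then Forall y \<phi> else Forall y (subst x t \<phi>))"

primrec substitutable :: "tm \<Rightarrow> nat \<Rightarrow> fm \<Rightarrow> bool" where
  "substitutable t x (Atom a) \<longleftrightarrow> True"
| "substitutable t x Bot \<longleftrightarrow> True"
| "substitutable t x (Imp \<phi> \<psi>) \<longleftrightarrow> substitutable t x \<phi> \<and> substitutable t x \<psi>"
| "substitutable t x (Forall y \<phi>) \<longleftrightarrow>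
     x \<notin> fv (Forall y \<phi>) \<or> y \<notin> fv_tm t \<and> substitutable t x \<phi>"

lemma finite_fv_tm [simp]: "finite (fv_tm t)"
  by (induction t) auto

lemma finite_fv [simp]: "finite (fv \<phi>)"
proof (induction \<phi>)
  case (Atom a)
  then show ?case by (cases a) simp
qed auto

definition univ_closure :: "fm \<Rightarrow> fm" where
  "univ_closure \<phi> = foldr Forall (sorted_list_of_set (fv \<phi>)) \<phi>"

lemma fv_foldr_Forall: "fv (foldr Forall xs \<phi>) = fv \<phi> - set xs"
  by (induction xs) auto

lemma closed_univ_closure: "closed_fm (univ_closure \<phi>)"
  by (simp add: closed_fm_def univ_closure_def fv_foldr_Forall)

text \<open>A rule consists of its premises and its conclusion. The atoms in it need not be closed.\<close>

type_synonym rule = "atom list \<times> atom"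

type_synonym base = "rule set"

inductive derivable :: "base \<Rightarrow> atom \<Rightarrow> bool" for B :: base where
  "\<lbrakk>(Ps, A) \<in> B; \<forall>P\<in>set Ps. derivable B P\<rbrakk> \<Longrightarrow> derivable B A"

text \<open>
  Termination measure for support; it ignores terms and is therefore invariant under substitution.
\<close>

primrec rank :: "fm \<Rightarrow> nat" where
  "rank (Atom a) = 0"
| "rank Bot = 1"
| "rank (Imp \<phi> \<psi>) = Suc (rank \<phi> + rank \<psi>)"
| "rank (Forall y \<phi>) = Suc (rank \<phi>)"

lemma rank_subst [simp]: "rank (subst x t \<phi>) = rank \<phi>"
  by (induction \<phi>) auto

text \<open>
  Support is meant for closed formulas only; its value on open ones is irrelevant, since the
  clauses lead from closed formulas to closed formulas. The clause for implication is support of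
  the conclusion from the singleton of the antecedent, written out (lemma \<open>support_Imp_iff\<close>).
\<close>

function support :: "base \<Rightarrow> fm \<Rightarrow> bool" where
  "support B (Atom a) \<longleftrightarrow> derivable B a"
| "support B (Imp \<phi> \<psi>) \<longleftrightarrow> (\<forall>C. B \<subseteq> C \<longrightarrow> support C \<phi> \<longrightarrow> support C \<psi>)"
| "support B (Forall x \<phi>) \<longleftrightarrow> (\<forall>t. closed_tm t \<longrightarrow> support B (subst x t \<phi>))"
| "support B Bot \<longleftrightarrow> (\<forall>a. closed_atom a \<longrightarrow> support B (Atom a))"
  by pat_completeness auto
termination by (relation "measure (\<lambda>(B, \<phi>). rank \<phi>)") auto

definition support_from :: "base \<Rightarrow> fm set \<Rightarrow> fm \<Rightarrow> bool" where
  "support_from B \<Delta> \<phi> \<longleftrightarrow>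
     (\<forall>C. B \<subseteq> C \<longrightarrow> (\<forall>\<psi>\<in>\<Delta>. support C \<psi>) \<longrightarrow> support C \<phi>)"

lemma support_Imp_iff: "support B (Imp \<phi> \<psi>) \<longleftrightarrow> support_from B {\<phi>} \<psi>"
  by (simp add: support_from_def)

definition entails :: "fm set \<Rightarrow> fm \<Rightarrow> bool" where
  "entails \<Gamma> \<phi> \<longleftrightarrow> (\<exists>\<Delta>. finite \<Delta> \<and> \<Delta> \<subseteq> \<Gamma> \<and> (\<forall>B. support_from B \<Delta> \<phi>))"

definition consistent :: "fm set \<Rightarrow> bool" where
  "consistent \<Gamma> \<longleftrightarrow> \<not> entails \<Gamma> Bot"

text \<open>
  In the schemas, the formula \<open>\<phi>(s)\<close> is rendered as \<open>subst x s \<phi>\<close> for a distinguished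
  variable \<open>x\<close>; in particular \<open>\<phi>(x)\<close> is \<open>\<phi>\<close> itself. The conditions in \<open>EQ4\<close> say that
  \<open>y\<close> is a new variable and that \<open>\<phi>(y)\<close> is free of variable capture.
\<close>

inductive_set PA :: "fm set" where
  EQ1: "Forall 0 (Equ (Var 0) (Var 0)) \<in> PA"
| EQ2: "Forall 0 (Forall 1 (Imp (Equ (Var 0) (Var 1)) (Equ (Var 1) (Var 0)))) \<in> PA"
| EQ3: "Forall 0 (Forall 1 (Forall 2
          (Imp (Equ (Var 0) (Var 1)) (Imp (Equ (Var 1) (Var 2)) (Equ (Var 0) (Var 2)))))) \<in> PA"
| EQ4: "\<lbrakk>y \<noteq> x; y \<notin> fv \<phi>; substitutable (Var y) x \<phi>\<rbrakk> \<Longrightarrow>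
        univ_closure (Forall x (Forall y
          (Imp (Equ (Var x) (Var y)) (Imp \<phi> (subst x (Var y) \<phi>))))) \<in> PA"
| PA1: "Forall 0 (Neg (Equ (Succ (Var 0)) Zero)) \<in> PA"
| PA2: "Forall 0 (Forall 1
          (Imp (Equ (Succ (Var 0)) (Succ (Var 1))) (Equ (Var 0) (Var 1)))) \<in> PA"
| PA3: "Forall 0 (Equ (Plus (Var 0) Zero) (Var 0)) \<in> PA"
| PA4: "Forall 0 (Forall 1
          (Equ (Plus (Var 0) (Succ (Var 1))) (Succ (Plus (Var 0) (Var 1))))) \<in> PA"
| PA5: "Forall 0 (Equ (Times (Var 0) Zero) Zero) \<in> PA"
| PA6: "Forall 0 (Forall 1
          (Equ (Times (Var 0) (Succ (Var 1))) (Plus (Times (Var 0) (Var 1)) (Var 0)))) \<in> PA"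
| PA7: "univ_closure
          (Imp (Conj (subst x Zero \<phi>) (Forall x (Imp \<phi> (subst x (Succ (Var x)) \<phi>))))
               (Forall x \<phi>)) \<in> PA"

lemma PA_closed: "\<phi> \<in> PA \<Longrightarrow> closed_fm \<phi>"
  by (induction rule: PA.induct) (auto simp: closed_univ_closure, auto simp: closed_fm_def)

end

theory Submission
  imports Defs
begin

text \<open>
  Let the base \<open>truth_base\<close> have every true closed equation as an axiom and, for every false
  closed equation, the rules inferring all closed atoms from it. An extension of this base either
  derives all closed atoms, and then supports every closed formula, or it derives exactly the true
  closed atoms. Hence, in an extension of the second kind, support of closed formulas is truth in
  the standard model: the extensions quantified over in the clause for implication are again of one
  of the two kinds, and the first kind refutes no implication. The base itself is of the second
  kind, so it supports \<open>PA\<close> but not \<open>\<bottom>\<close>.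
\<close>

section \<open>Truth in the standard model\<close>

primrec eval_tm :: "(nat \<Rightarrow> nat) \<Rightarrow> tm \<Rightarrow> nat" where
  "eval_tm e (Var y) = e y"
| "eval_tm e Zero = 0"
| "eval_tm e (Succ t) = Suc (eval_tm e t)"
| "eval_tm e (Plus s t) = eval_tm e s + eval_tm e t"
| "eval_tm e (Times s t) = eval_tm e s * eval_tm e t"

primrec sat_atom :: "(nat \<Rightarrow> nat) \<Rightarrow> atom \<Rightarrow> bool" where
  "sat_atom e (Eq s t) \<longleftrightarrow> eval_tm e s = eval_tm e t"

primrec sat :: "(nat \<Rightarrow> nat) \<Rightarrow> fm \<Rightarrow> bool" where
  "sat e (Atom a) \<longleftrightarrow> sat_atom e a"
| "sat e Bot \<longleftrightarrow> False"
| "sat e (Imp \<phi> \<psi>) \<longleftrightarrow> (sat e \<phi> \<longrightarrow> sat e \<psi>)"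
| "sat e (Forall y \<phi>) \<longleftrightarrow> (\<forall>n. sat (e(y := n)) \<phi>)"

lemma eval_tm_cong: "(\<And>y. y \<in> fv_tm t \<Longrightarrow> e y = e' y) \<Longrightarrow> eval_tm e t = eval_tm e' t"
  by (induction t) auto

lemma sat_atom_cong: "(\<And>y. y \<in> fv_atom a \<Longrightarrow> e y = e' y) \<Longrightarrow> sat_atom e a \<longleftrightarrow> sat_atom e' a"
proof (cases a)
  case (Eq s t)
  assume "\<And>y. y \<in> fv_atom a \<Longrightarrow> e y = e' y"
  with Eq show ?thesis using eval_tm_cong[of s e e'] eval_tm_cong[of t e e'] by simp
qed

lemma sat_cong: "(\<And>y. y \<in> fv \<phi> \<Longrightarrow> e y = e' y) \<Longrightarrow> sat e \<phi> \<longleftrightarrow> sat e' \<phi>"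
proof (induction \<phi> arbitrary: e e')
  case (Atom a)
  then show ?case using sat_atom_cong[of a e e'] by simp
next
  case (Imp \<phi> \<psi>)
  have "sat e \<phi> \<longleftrightarrow> sat e' \<phi>" "sat e \<psi> \<longleftrightarrow> sat e' \<psi>"
    by (rule Imp.IH; simp add: Imp.prems)+
  then show ?case by simp
next
  case (Forall x \<phi>)
  have "sat (e(x := n)) \<phi> \<longleftrightarrow> sat (e'(x := n)) \<phi>" for n
    by (rule Forall.IH) (simp add: Forall.prems)
  then show ?case by simp
qed simp

section \<open>Substitution and truth\<close>

lemma eval_subst_tm: "eval_tm e (subst_tm x t s) = eval_tm (e(x := eval_tm e t)) s"
  by (induction s) auto

lemma subst_not_free_tm: "x \<notin> fv_tm s \<Longrightarrow> subst_tm x t s = s"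
  by (induction s) auto

lemma subst_not_free: "x \<notin> fv \<phi> \<Longrightarrow> subst x t \<phi> = \<phi>"
proof (induction \<phi>)
  case (Atom a)
  then show ?case by (cases a) (simp add: subst_not_free_tm)
qed auto

lemma sat_subst:
  "substitutable t x \<phi> \<Longrightarrow> sat e (subst x t \<phi>) \<longleftrightarrow> sat (e(x := eval_tm e t)) \<phi>"
proof (induction \<phi> arbitrary: e)
  case (Atom a)
  then show ?case by (cases a) (simp add: eval_subst_tm fun_upd_def)
next
  case (Forall y \<phi>)
  show ?case
  \<comment> \<open>If \<open>x\<close> is not free, \<open>substitutable\<close> gives no
    protection against capture, but the substitution changes nothing. This case also covers
    \<open>y = x\<close>.\<close>
  proof (cases "x \<in> fv (Forall y \<phi>)")
    case False
    then have "sat e (Forall y \<phi>) \<longleftrightarrow> sat (e(x := eval_tm e t)) (Forall y \<phi>)"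
      by (intro sat_cong) auto
    with False show ?thesis by (simp only: subst_not_free not_False_eq_True)
  next
    case True
    with Forall.prems have *: "y \<notin> fv_tm t" "substitutable t x \<phi>" "y \<noteq> x" by auto
    have "sat (e(y := n)) (subst x t \<phi>) \<longleftrightarrow> sat (e(x := eval_tm e t, y := n)) \<phi>" for n
    proof -
      have "eval_tm (e(y := n)) t = eval_tm e t"
        using *(1) by (intro eval_tm_cong) auto
      then show ?thesis
        using Forall.IH[OF *(2), of "e(y := n)"] fun_upd_twist[OF *(3), of e n "eval_tm e t"]
        by (simp only:)
    qed
    with *(3) show ?thesis by (simp only: subst.simps sat.simps if_False)
  qed
qed simp_all

lemma substitutable_closed: "closed_tm t \<Longrightarrow> substitutable t x \<phi>"
  by (induction \<phi>) (auto simp: closed_tm_def)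

text \<open>A quantifier could capture only \<open>x\<close>, and below a quantifier over
  \<open>x\<close> nothing is replaced. This serves \<open>Zero\<close> and
  \<open>Succ (Var x)\<close> in the induction schema.\<close>

lemma substitutable_self: "fv_tm t \<subseteq> {x} \<Longrightarrow> substitutable t x \<phi>"
  by (induction \<phi>) auto

lemma fv_subst_tm: "closed_tm t \<Longrightarrow> fv_tm (subst_tm x t s) = fv_tm s - {x}"
  by (induction s) (auto simp: closed_tm_def)

lemma fv_subst: "closed_tm t \<Longrightarrow> fv (subst x t \<phi>) = fv \<phi> - {x}"
proof (induction \<phi>)
  case (Atom a)
  then show ?case by (cases a) (auto simp: fv_subst_tm)
qed auto

lemma closed_subst: "closed_fm (Forall x \<phi>) \<Longrightarrow> closed_tm t \<Longrightarrow> closed_fm (subst x t \<phi>)"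
  by (simp add: closed_fm_def fv_subst)

lemma closed_tm_with_value: "\<exists>t. closed_tm t \<and> eval_tm e t = n"
proof (induction n)
  case 0
  show ?case by (rule exI[of _ Zero]) (simp add: closed_tm_def)
next
  case (Suc n)
  then obtain t where "closed_tm t" "eval_tm e t = n" by blast
  then show ?case by (intro exI[of _ "Succ t"]) (simp add: closed_tm_def)
qed

text \<open>Numerals name every number, so the clause of support for the quantifier, which ranges
  over closed terms, misses no element of the standard model.\<close>

lemma sat_Forall_closed_instances:
  "sat e (Forall x \<phi>) \<longleftrightarrow> (\<forall>t. closed_tm t \<longrightarrow> sat e (subst x t \<phi>))"
proof
  assume inst: "\<forall>t. closed_tm t \<longrightarrow> sat e (subst x t \<phi>)"
  have "sat (e(x := n)) \<phi>" for n
  proof -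
    obtain t where "closed_tm t" "eval_tm e t = n"
      using closed_tm_with_value by blast
    with inst show ?thesis
      by (auto simp: sat_subst substitutable_closed)
  qed
  then show "sat e (Forall x \<phi>)" by simp
qed (simp add: sat_subst substitutable_closed)

lemma sat_univ_closure: "(\<And>e. sat e \<phi>) \<Longrightarrow> sat e (univ_closure \<phi>)"
proof -
  assume "\<And>e. sat e \<phi>"
  then have "sat e (foldr Forall xs \<phi>)" for xs
    by (induction xs arbitrary: e) auto
  then show ?thesis by (simp add: univ_closure_def)
qed

lemma sat_PA: "\<phi> \<in> PA \<Longrightarrow> sat e \<phi>"
proof (induction arbitrary: e rule: PA.induct)
  case (EQ4 y x \<phi>)
  \<comment> \<open>The equation forces the same value \<open>n\<close> on both variables, so
    setting \<open>x\<close> to the value of \<open>y\<close> leaves the assignment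
    unchanged.\<close>
  have "sat (e(x := n, y := n)) (subst x (Var y) \<phi>)"
    if "sat (e(x := n, y := n)) \<phi>" for e n
    using that EQ4 by (simp add: sat_subst fun_upd_twist)
  then show ?case by (intro sat_univ_closure) (simp add: EQ4(1) EQ4(1)[symmetric])
next
  case (PA7 x \<phi>)
  show ?case
  proof (rule sat_univ_closure)
    fix e
    \<comment> \<open>The schema reduces to induction on the value of \<open>x\<close>: under
      \<open>e(x := n)\<close> the term \<open>Succ (Var x)\<close> has the value
      \<open>Suc n\<close>.\<close>
    have "sat (e(x := n)) \<phi>"
      if "sat (e(x := 0)) \<phi>" "\<And>n. sat (e(x := n)) \<phi> \<Longrightarrow> sat (e(x := Suc n)) \<phi>" for n
      using that by (induction n) auto
    then show "sat e (Imp (Conj (subst x Zero \<phi>) (Forall x (Imp \<phi> (subst x (Succ (Var x)) \<phi>))))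
        (Forall x \<phi>))"
      by (auto simp: sat_subst substitutable_self)
  qed
qed auto

section \<open>The truth base and its extensions\<close>

abbreviation true_atom :: "atom \<Rightarrow> bool" where
  "true_atom \<equiv> sat_atom (\<lambda>_. 0)"

definition truth_base :: base where
  "truth_base =
     {([], A) | A. closed_atom A \<and> true_atom A} \<union>
     {([A], C) | A C. closed_atom A \<and> \<not> true_atom A \<and> closed_atom C}"

definition explosive :: "base \<Rightarrow> bool" where
  "explosive B \<longleftrightarrow> (\<forall>a. closed_atom a \<longrightarrow> derivable B a)"

lemma derivable_mono: "derivable B a \<Longrightarrow> B \<subseteq> C \<Longrightarrow> derivable C a"
proof (induction rule: derivable.induct)
  case (1 Ps A)
  then show ?case by (intro derivable.intros[of Ps A C]) auto
qed

lemma explosive_mono: "explosive B \<Longrightarrow> B \<subseteq> C \<Longrightarrow> explosive C"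
  using derivable_mono by (auto simp: explosive_def)

text \<open>The rules with a premise never fire: by induction their premise would be true, but it is
  false by choice.\<close>

lemma derivable_truth_base: "derivable truth_base a \<Longrightarrow> true_atom a"
  by (induction rule: derivable.induct) (auto simp: truth_base_def)

lemma not_explosive_truth_base: "\<not> explosive truth_base"
proof
  assume "explosive truth_base"
  then have "derivable truth_base (Eq Zero (Succ Zero))"
    by (simp add: explosive_def closed_atom_def)
  then show False by (auto dest: derivable_truth_base)
qed

text \<open>The added rules of \<open>B\<close> may be arbitrary, but once they yield a single false
  closed atom, the rules of \<open>truth_base\<close> yield all closed atoms.\<close>

lemma derivable_iff_true:
  assumes "truth_base \<subseteq> B" "\<not> explosive B" "closed_atom a"
  shows "derivable B a \<longleftrightarrow> true_atom a"
proof
  assume "true_atom a"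
  with assms have "([], a) \<in> B" by (auto simp: truth_base_def)
  then show "derivable B a" by (rule derivable.intros) simp
next
  assume a: "derivable B a"
  show "true_atom a"
  proof (rule ccontr)
    assume "\<not> true_atom a"
    with assms have "([a], C) \<in> B" if "closed_atom C" for C
      using that by (auto simp: truth_base_def)
    then have "derivable B C" if "closed_atom C" for C
      using that a by (intro derivable.intros[of "[a]" C]) auto
    then have "explosive B" by (simp add: explosive_def)
    with assms show False by simp
  qed
qed

text \<open>In the case of an implication, every extension is explosive again, so the induction
  hypothesis supports the conclusion outright.\<close>

lemma support_explosive: "explosive B \<Longrightarrow> closed_fm \<phi> \<Longrightarrow> support B \<phi>"
proof (induction B \<phi> rule: support.induct)
  case (2 B \<phi> \<psi>)
  then show ?case by (auto simp: closed_fm_def dest: explosive_mono)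
next
  case (3 B x \<phi>)
  then show ?case by (simp add: closed_subst)
qed (auto simp: explosive_def closed_fm_def closed_atom_def)

lemma support_iff_sat:
  "truth_base \<subseteq> B \<Longrightarrow> \<not> explosive B \<Longrightarrow> closed_fm \<phi> \<Longrightarrow> support B \<phi> \<longleftrightarrow> sat (\<lambda>_. 0) \<phi>"
proof (induction B \<phi> rule: support.induct)
  case (1 B a)
  then show ?case by (simp add: derivable_iff_true closed_fm_def closed_atom_def)
next
  case (2 B \<phi> \<psi>)
  have closed: "closed_fm \<phi>" "closed_fm \<psi>"
    using 2 by (auto simp: closed_fm_def)
  show ?case
  proof
    assume "support B (Imp \<phi> \<psi>)"
    \<comment> \<open>It suffices to take \<open>B\<close> itself as the extension.\<close>
    then show "sat (\<lambda>_. 0) (Imp \<phi> \<psi>)"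
      using 2 closed by auto
  next
    assume imp: "sat (\<lambda>_. 0) (Imp \<phi> \<psi>)"
    have "support C \<psi>" if C: "B \<subseteq> C" "support C \<phi>" for C
    proof (cases "explosive C")
      case True
      then show ?thesis using closed by (simp add: support_explosive)
    next
      case False
      then show ?thesis using 2 C closed imp by auto
    qed
    then show "support B (Imp \<phi> \<psi>)" by simp
  qed
next
  case (3 B x \<phi>)
  then show ?case
    \<comment> \<open>Both sides become statements about all closed instances before the clause of
      \<open>sat\<close> can introduce numbers.\<close>
    by (simp only: sat_Forall_closed_instances support.simps closed_subst) (simp add: closed_subst)
next
  case (4 B)
  \<comment> \<open>Support of \<open>Bot\<close> is explosiveness, which is excluded.\<close>
  then show ?case by (simp add: explosive_def)
qed

theorem theorem9: "consistent PA"
  unfolding consistent_def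
proof
  assume "entails PA Bot"
  then obtain \<Delta> where "\<Delta> \<subseteq> PA" "support_from truth_base \<Delta> Bot"
    by (auto simp: entails_def)
  moreover have "support truth_base \<psi>" if "\<psi> \<in> PA" for \<psi>
    using that not_explosive_truth_base by (simp add: support_iff_sat sat_PA PA_closed)
  ultimately have "support truth_base Bot"
    by (auto simp: support_from_def)
  then show False
    using not_explosive_truth_base by (simp add: explosive_def)
qed

end
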